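(* Assume that there are $K=2$ arms such that $\mu_1>\mu_2$, and let $\alpha\ge0$. Then, under Thompson sampling such that $\tilde\mu_1(t)\sim\pi(\mu_1|\hat\theta_1(t))$ with parameter $\alpha$ and $\tilde\mu_2(t)=\mu_2$, there exists a constant $\xi>0$ independent of $\sigma_2$ such that $$\liminf_{T\to\infty}\frac{\mathrm{E}[\mathrm{Regret}(T)]}{\log T}\ge\xi.$$ In particular, if $\alpha>0$ then there exist $\xi'>0$ and $\eta>0$ such that $$\liminf_{T\to\infty}\frac{\mathrm{E}[\mathrm{Regret}(T)]}{T^{\eta}}\ge\xi'.$$
   Context: Bandit model. There are two arms. The $n$-th reward from arm $i\in\{1,2\}$ is $X_{i,n}$; all rewards are independent and $X_{i,n}\sim\mathcal{N}(\mu_i,\sigma_i^2)$ with $(\mu_i,\sigma_i^2)\in\mathbb{R}\times(0,\infty)$. At each round $t=1,2,\dots$ one arm $J(t)$ is pulled and the next reward of that arm is received. $N_i(t)$ is the number of times arm $i$ is pulled before the $t$-th round. With $\mu^*=\max_i\mu_i$ and $\Delta_i=\mu^*-\mu_i$, the regret is $\mathrm{Regret}(T)=\sum_{t=1}^T\Delta_{J(t)}$. Statistics. $\bar{x}_{i,n}=\frac1n\sum_{m=1}^nX_{i,m}$ and $S_{i,n}=\sum_{m=1}^n(X_{i,m}-\bar{x}_{i,n})^2$, with $\hat\theta_{i,n}=(\bar x_{i,n},S_{i,n})$ and $\hat\theta_i(t)=\hat\theta_{i,N_i(t)}$. Posterior for arm 1. Under the (improper) prior $\pi(\mu_1,\sigma_1^2)\propto(\sigma_1^2)^{-1-\alpha}$,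 the posterior of $\mu_1$ given $n$ samples is the probability density $\pi(\mu_1|\hat\theta_{1,n})\propto\left(1+\frac{n(\mu_1-\bar x_{1,n})^2}{S_{1,n}}\right)^{-\frac n2-\alpha}$; equivalently $\sqrt{\frac{n(n+2\alpha-1)}{S_{1,n}}}(\mu_1-\bar x_{1,n})$ has the Student $t$-distribution with $n+2\alpha-1$ degrees of freedom. Policy. The parameters of arm 2 are fully known beforehand (its prior is the unit point mass at $(\mu_2,\sigma_2^2)$). Initialization: pull each arm $n_0=\max\{2,3-\lceil2\alpha\rceil\}$ times. Then at each subsequent round $t$: given the past, sample $\tilde\mu_1(t)$ from $\pi(\mu_1|\hat\theta_1(t))$, set $\tilde\mu_2(t)=\mu_2$, and pull an arm $i$ maximizing $\tilde\mu_i(t)$. *)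

theory Defs
  imports "HOL-Probability.Probability"
begin

text \<open>
  Arms are the natural numbers 1 and 2, and rounds as well as the rewards of each arm are numbered
  from 1. \<open>X i n\<close> is the reward of the \<open>n\<close>-th pull of arm \<open>i\<close>, \<open>J t\<close> the arm pulled in round \<open>t\<close>,
  \<open>mt i t\<close> the value sampled for arm \<open>i\<close> in round \<open>t\<close>, and \<open>sd i\<close> the standard deviation
  of arm \<open>i\<close>.
\<close>

definition arms :: "nat set" where
  "arms = {1, 2}"

definition gap :: "(nat \<Rightarrow> real) \<Rightarrow> nat \<Rightarrow> real" where
  "gap mu i = Max (mu ` arms) - mu i"

definition regret :: "(nat \<Rightarrow> real) \<Rightarrow> (nat \<Rightarrow> 'a \<Rightarrow> nat) \<Rightarrow> nat \<Rightarrow> 'a \<Rightarrow> real" where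
  "regret mu J T \<omega> = (\<Sum>t = 1..T. gap mu (J t \<omega>))"

text \<open>The number of pulls of arm \<open>i\<close> strictly before round \<open>t\<close>.\<close>

definition pulls :: "(nat \<Rightarrow> 'a \<Rightarrow> nat) \<Rightarrow> nat \<Rightarrow> nat \<Rightarrow> 'a \<Rightarrow> nat" where
  "pulls J i t \<omega> = card {s \<in> {1..<t}. J s \<omega> = i}"

definition sample_mean :: "(nat \<Rightarrow> nat \<Rightarrow> 'a \<Rightarrow> real) \<Rightarrow> nat \<Rightarrow> nat \<Rightarrow> 'a \<Rightarrow> real" where
  "sample_mean X i n \<omega> = (\<Sum>m = 1..n. X i m \<omega>) / real n"

definition sample_ss :: "(nat \<Rightarrow> nat \<Rightarrow> 'a \<Rightarrow> real) \<Rightarrow> nat \<Rightarrow> nat \<Rightarrow> 'a \<Rightarrow> real" where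
  "sample_ss X i n \<omega> = (\<Sum>m = 1..n. (X i m \<omega> - sample_mean X i n \<omega>)\<^sup>2)"

definition posterior_weight :: "real \<Rightarrow> nat \<Rightarrow> real \<Rightarrow> real \<Rightarrow> real \<Rightarrow> real" where
  "posterior_weight \<alpha> n x S m = (1 + real n * (m - x)\<^sup>2 / S) powr (- (real n / 2) - \<alpha>)"

text \<open>
  The marginal posterior of the mean under the improper prior proportional to
  \<open>(\<sigma>\<^sup>2) powr (- 1 - \<alpha>)\<close>, given \<open>n\<close> observations with mean \<open>x\<close> and sum of squared deviations \<open>S\<close>.
  It is a probability measure if \<open>S > 0\<close> and \<open>n + 2 * \<alpha> > 1\<close>, a location-scale Student distribution
  with \<open>n + 2 * \<alpha> - 1\<close> degrees of freedom; for \<open>S = 0\<close> the value is irrelevant, since this case has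
  probability 0 when \<open>n \<ge> 2\<close>.
\<close>

definition posterior :: "real \<Rightarrow> nat \<Rightarrow> real \<Rightarrow> real \<Rightarrow> real measure" where
  "posterior \<alpha> n x S = density lborel
     (\<lambda>m. ennreal (posterior_weight \<alpha> n x S m / (LBINT u. posterior_weight \<alpha> n x S u)))"

definition init_pulls :: "real \<Rightarrow> nat" where
  "init_pulls \<alpha> = nat (max 2 (3 - \<lceil>2 * \<alpha>\<rceil>))"

text \<open>
  The information on which the sample of round \<open>t\<close> is conditioned: the arms pulled and the values
  sampled before round \<open>t\<close>, and the whole reward table. Including rewards that have not been received
  yet expresses that the randomisation of the policy cannot depend on them: conditioning on the
  observed history alone would not exclude a policy coupled with future rewards.
\<close>

definition past ::
  "'a measure \<Rightarrow> (nat \<Rightarrow> nat \<Rightarrow> 'a \<Rightarrow> real) \<Rightarrow> (nat \<Rightarrow> nat \<Rightarrow> 'a \<Rightarrow> real) \<Rightarrow> (nat \<Rightarrow> 'a \<Rightarrow> nat)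
    \<Rightarrow> nat \<Rightarrow> nat \<Rightarrow> 'a measure" where
  "past M X mt J t0 t = sigma (space M)
     ({X i n -` A \<inter> space M | i n A. i \<in> arms \<and> 1 \<le> n \<and> A \<in> sets borel} \<union>
      {mt i s -` A \<inter> space M | i s A. i \<in> arms \<and> t0 < s \<and> s < t \<and> A \<in> sets borel} \<union>
      {J s -` A \<inter> space M | s A. 1 \<le> s \<and> s < t})"

locale gaussian_bandit = prob_space M
  for M :: "'a measure" +
  fixes mu sd :: "nat \<Rightarrow> real"
    and X :: "nat \<Rightarrow> nat \<Rightarrow> 'a \<Rightarrow> real"
  assumes sd_pos: "\<And>i. i \<in> arms \<Longrightarrow> 0 < sd i"
    and rewards_normal:
      "\<And>i n. i \<in> arms \<Longrightarrow> 1 \<le> n \<Longrightarrow> distributed M lborel (X i n) (normal_density (mu i) (sd i))"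
    and rewards_indep: "indep_vars (\<lambda>_. borel) (\<lambda>(i, n). X i n) (arms \<times> {1..})"

text \<open>
  Thompson sampling when arm 2 is known. The order of the pulls in the initialisation phase and the
  choice between arms in case of ties are arbitrary.
\<close>

locale thompson_sampling_known_arm2 = gaussian_bandit M mu sd X
  for M :: "'a measure" and mu sd :: "nat \<Rightarrow> real" and X :: "nat \<Rightarrow> nat \<Rightarrow> 'a \<Rightarrow> real" +
  fixes \<alpha> :: real
    and mt :: "nat \<Rightarrow> nat \<Rightarrow> 'a \<Rightarrow> real"
    and J :: "nat \<Rightarrow> 'a \<Rightarrow> nat"
  assumes pulled_measurable: "\<And>t. 1 \<le> t \<Longrightarrow> J t \<in> measurable M (count_space UNIV)"
    and pulled_arm: "\<And>t \<omega>. 1 \<le> t \<Longrightarrow> \<omega> \<in> space M \<Longrightarrow> J t \<omega> \<in> arms"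
    and init_phase:
      "\<And>i \<omega>. i \<in> arms \<Longrightarrow> \<omega> \<in> space M \<Longrightarrow> pulls J i (2 * init_pulls \<alpha> + 1) \<omega> = init_pulls \<alpha>"
    and sample1_measurable: "\<And>t. 2 * init_pulls \<alpha> < t \<Longrightarrow> mt 1 t \<in> borel_measurable M"
    and sample1_posterior:
      "\<And>t A. 2 * init_pulls \<alpha> < t \<Longrightarrow> A \<in> sets borel \<Longrightarrow>
        AE \<omega> in M. real_cond_exp M (past M X mt J (2 * init_pulls \<alpha>) t)
                     (\<lambda>\<omega>. indicator A (mt 1 t \<omega>)) \<omega>
          = measure (posterior \<alpha> (pulls J 1 t \<omega>)
                      (sample_mean X 1 (pulls J 1 t \<omega>) \<omega>) (sample_ss X 1 (pulls J 1 t \<omega>) \<omega>)) A"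
    and sample2_known:
      "\<And>t \<omega>. 2 * init_pulls \<alpha> < t \<Longrightarrow> \<omega> \<in> space M \<Longrightarrow> mt 2 t \<omega> = mu 2"
    and pull_maximal:
      "\<And>t \<omega> i. 2 * init_pulls \<alpha> < t \<Longrightarrow> \<omega> \<in> space M \<Longrightarrow> i \<in> arms \<Longrightarrow> mt i t \<omega> \<le> mt (J t \<omega>) t \<omega>"

end

theory Submission
  imports Defs
begin

text \<open>
  Thompson sampling loses because the better arm 1 can start with rewards that are both low and
  close together. Let \<open>n = init_pulls \<alpha>\<close> and suppose that its first \<open>n\<close> rewards lie in one interval of
  length \<open>1 / N\<close> at distance at least 1 below \<open>mu 2\<close>. The posterior of \<open>mu 1\<close> is then a Student
  distribution of scale about \<open>1 / N\<close> with \<open>q = n + 2 * \<alpha> - 1\<close> degrees of freedom, so that a sample from it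
  reaches \<open>mu 2\<close> with probability at most \<open>C / N powr q\<close> (\<open>posterior_tail_le\<close>). As long as this does
  not happen, arm 1 is not pulled, its statistics do not change and the bound stays in force. By a
  union bound over the rounds (\<open>prob_samples1_stay_low\<close>), with \<open>N\<close> of order \<open>t powr (1 / q)\<close>, arm 1 is
  not pulled again before round \<open>t + 1\<close> with conditional probability at least 1/2.

  Such a bad start is rare but not rare enough. There are \<open>N\<close> disjoint intervals of length \<open>1 / N\<close>
  in an interval of length 1, and each contains all \<open>n\<close> rewards with probability at least
  \<open>(\<delta> / N) ^ n\<close>, where \<open>\<delta>\<close> bounds the reward density from below; so the bad start has probability at
  least a constant times \<open>1 / N ^ (n - 1)\<close> (\<open>prob_common_cell_ge\<close>). Altogether arm 2 is pulled in
  round \<open>t\<close> with probability at least \<open>c * t powr (- \<gamma>)\<close>, where \<open>\<gamma> = (n - 1) / (n - 1 + 2 * \<alpha>)\<close>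
  (\<open>prob_pull_arm2_ge\<close>). If \<open>\<alpha> > 0\<close>, then \<open>\<gamma> < 1\<close> and summation over \<open>t\<close> gives regret of order
  \<open>T powr (1 - \<gamma>)\<close>; if \<open>\<alpha> = 0\<close>, then \<open>\<gamma> = 1\<close> and the harmonic sum gives the logarithm. The constants
  come from the reward distribution of arm 1, from \<open>mu 2\<close> and from \<open>\<alpha>\<close>, and hence do not depend on
  the variance of arm 2.
\<close>

section \<open>Tail of the posterior\<close>

text \<open>
  With the scale \<open>r = sqrt (S / n)\<close> the posterior weight is \<open>(1 + ((m - x) / r)\<^sup>2) powr (- (q + 1) / 2)\<close>.
  Beyond \<open>y\<close> it is dominated by the power \<open>((m - x) / r) powr (- (q + 1))\<close>, whose integral is explicit,
  while on \<open>{x..x + r}\<close> it is at least \<open>2 powr (- (q + 1) / 2)\<close>, which bounds the normalising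
  constant from below.
\<close>

lemma posterior_tail_le:
  fixes \<alpha> q x y S :: real and n :: nat
  assumes n: "1 \<le> n" and q_def: "q = real n + 2 * \<alpha> - 1" and q: "0 < q"
    and S: "0 \<le> S" and xy: "x < y"
  shows "measure (posterior \<alpha> n x S) {y..}
           \<le> 2 powr ((q + 1) / 2) / q * (sqrt (S / real n) / (y - x)) powr q"
proof -
  define w where "w = posterior_weight \<alpha> n x S"
  define Z where "Z = (LBINT u. w u)"
  define k where "k = (q + 1) / 2"
  have w_nonneg: "0 \<le> w m" for m
    by (simp add: w_def posterior_weight_def)
  have w_meas[measurable]: "w \<in> borel_measurable borel"
    unfolding w_def posterior_weight_def by measurable
  have Z_nonneg: "0 \<le> Z"
    unfolding Z_def using w_nonneg by (intro integral_nonneg_AE) auto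
  have post: "posterior \<alpha> n x S = density lborel (\<lambda>m. ennreal (w m / Z))"
    by (simp add: posterior_def w_def Z_def)
  show ?thesis
  proof (cases "Z = 0")
    case True
    \<comment> \<open>Division by 0 makes the density vanish; this covers \<open>S = 0\<close>, where the weight is constantly 1.\<close>
    have "emeasure (posterior \<alpha> n x S) {y..} = 0"
      unfolding post True by (subst emeasure_density) auto
    then have "measure (posterior \<alpha> n x S) {y..} = 0"
      by (simp add: measure_def)
    then show ?thesis
      using q by simp
  next
    case False
    with Z_nonneg have Z: "0 < Z" by simp
    have int: "integrable lborel w"
      using False not_integrable_integral_eq unfolding Z_def by blast
    have "S \<noteq> 0"
    proof
      assume "S = 0"
      then have "w = (\<lambda>_. 1)"
        by (simp add: w_def posterior_weight_def fun_eq_iff)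
      then show False
        using False by (simp add: Z_def measure_def)
    qed
    define r where "r = sqrt (S / real n)"
    have r: "0 < r"
      using S \<open>S \<noteq> 0\<close> n by (simp add: r_def)
    have w_eq: "w m = (1 + ((m - x) / r)\<^sup>2) powr (- k)" for m
    proof -
      have "((m - x) / r)\<^sup>2 = real n * (m - x)\<^sup>2 / S"
        using S \<open>S \<noteq> 0\<close> n by (simp add: r_def power_divide field_simps)
      moreover have "- (real n / 2) - \<alpha> = - k"
        by (simp add: k_def q_def field_simps)
      ultimately show ?thesis
        by (simp add: w_def posterior_weight_def)
    qed
    have k: "0 < k"
      using q by (simp add: k_def)
    have Z_ge: "r * 2 powr (- k) \<le> Z"
    proof -
      have "r * 2 powr (- k) = (LBINT m. 2 powr (- k) * indicator {x..x + r} m)"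
        using r by simp
      also have "\<dots> \<le> Z"
        unfolding Z_def
      proof (rule integral_mono[OF _ int])
        show "integrable lborel (\<lambda>m. 2 powr (- k) * indicator {x..x + r} m :: real)"
          using r by (intro integrable_mult_right integrable_real_indicator) auto
        fix m
        show "2 powr (- k) * indicator {x..x + r} m \<le> w m"
        proof (cases "m \<in> {x..x + r}")
          case True
          then have "((m - x) / r)\<^sup>2 \<le> 1"
            using r by (intro power_le_one) auto
          moreover have "0 < 1 + ((m - x) / r)\<^sup>2"
            by (simp add: add_pos_nonneg)
          ultimately show ?thesis
            using True k by (simp add: w_eq) (intro powr_mono2'; simp)
        qed (simp add: w_nonneg)
      qed
      finally show ?thesis .
    qed
    define K where "K = r powr (q + 1) / Z"
    have w_le: "w m \<le> r powr (q + 1) * (m - x) powr (- (q + 1))" if "y \<le> m" for m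
    proof -
      have pos: "0 < m - x"
        using that xy by simp
      have "w m \<le> (((m - x) / r)\<^sup>2) powr (- k)"
        unfolding w_eq using pos r k by (intro powr_mono2') auto
      also have "\<dots> = ((m - x) / r) powr (- (q + 1))"
      proof -
        have "((m - x) / r)\<^sup>2 = ((m - x) / r) powr 2"
          using pos r by simp
        then show ?thesis
          by (simp only: powr_powr) (simp add: k_def add_divide_distrib algebra_simps)
      qed
      also have "\<dots> = r powr (q + 1) * (m - x) powr (- (q + 1))"
        using pos r by (simp only: powr_divide powr_minus) (simp add: field_simps)
      finally show ?thesis .
    qed
    have tail: "(\<integral>\<^sup>+m. ennreal (K * (m - x) powr (- (q + 1))) * indicator {y..} m \<partial>lborel)
        = ennreal (0 - (- (K / q) * (y - x) powr (- q)))"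
    proof (rule nn_integral_FTC_atLeast[where F = "\<lambda>m. - (K / q) * (m - x) powr (- q)"])
      fix m assume "y \<le> m"
      with xy have pos: "0 < m - x" by simp
      show "((\<lambda>m. - (K / q) * (m - x) powr (- q)) has_real_derivative
              K * (m - x) powr (- (q + 1))) (at m)"
        using pos q by (auto intro!: derivative_eq_intros simp: powr_diff powr_add powr_minus field_simps)
      show "0 \<le> K * (m - x) powr (- (q + 1))"
        using Z by (simp add: K_def)
    next
      have "LIM m at_top. m - x :> at_top"
        using filterlim_tendsto_add_at_top[OF tendsto_const[of "- x"] filterlim_ident] by simp
      then have "((\<lambda>m. (m - x) powr (- q)) \<longlongrightarrow> 0) at_top"
        using q by (intro tendsto_neg_powr) auto
      then show "((\<lambda>m. - (K / q) * (m - x) powr (- q)) \<longlongrightarrow> 0) at_top"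
        using tendsto_mult_right_zero by blast
    qed simp
    have "emeasure (posterior \<alpha> n x S) {y..}
        = (\<integral>\<^sup>+m. ennreal (w m / Z) * indicator {y..} m \<partial>lborel)"
      unfolding post by (subst emeasure_density) auto
    also have "\<dots> \<le> (\<integral>\<^sup>+m. ennreal (K * (m - x) powr (- (q + 1))) * indicator {y..} m \<partial>lborel)"
    proof (rule nn_integral_mono)
      fix m
      show "ennreal (w m / Z) * indicator {y..} m
          \<le> ennreal (K * (m - x) powr (- (q + 1))) * indicator {y..} m"
        using w_le[of m] Z
        by (auto split: split_indicator intro!: ennreal_leI simp: K_def field_simps)
    qed
    also have "\<dots> = ennreal (K / q * (y - x) powr (- q))"
      unfolding tail by simp
    finally have "measure (posterior \<alpha> n x S) {y..} \<le> K / q * (y - x) powr (- q)"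
      using Z q by (simp add: measure_def enn2real_leI K_def)
    also have "\<dots> \<le> (r powr (q + 1) / (r * 2 powr (- k))) / q * (y - x) powr (- q)"
      unfolding K_def using Z_ge Z q r
      by (intro mult_right_mono divide_right_mono divide_left_mono mult_pos_pos) auto
    also have "\<dots> = 2 powr k / q * (r / (y - x)) powr q"
      using r xy q by (simp add: powr_divide powr_minus powr_add field_simps)
    finally show ?thesis
      by (simp add: k_def r_def)
  qed
qed

section \<open>Clustered observations\<close>

text \<open>
  For \<open>j < N\<close> these cells partition \<open>{a..<a + 1}\<close>; they are half-open so that they are disjoint.
\<close>

definition grid_cell :: "real \<Rightarrow> nat \<Rightarrow> nat \<Rightarrow> real set" where
  "grid_cell a N j = {a + real j / real N ..< a + (real j + 1) / real N}"

lemma grid_cell_sets[measurable, simp]: "grid_cell a N j \<in> sets borel"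
  by (simp add: grid_cell_def)

lemma grid_cell_unique:
  assumes "0 < N" and "z \<in> grid_cell a N i" and "z \<in> grid_cell a N j"
  shows "i = j"
proof -
  have "real i < real j + 1" "real j < real i + 1"
    using assms unfolding grid_cell_def by (auto simp: field_simps)
  then show ?thesis by linarith
qed

lemma grid_cell_subset:
  assumes "j < N"
  shows "grid_cell a N j \<subseteq> {a..<a + 1}"
proof -
  have "real j + 1 \<le> real N" using assms by linarith
  then have "(real j + 1) / real N \<le> 1" using assms by simp
  moreover have "0 \<le> real j / real N" by simp
  ultimately show ?thesis unfolding grid_cell_def by auto
qed

text \<open>
  By independence each cell contains all observations with probability at least
  \<open>(\<delta> / N) ^ card I\<close>. The gain of one factor \<open>N\<close> comes from the choice among \<open>N\<close> disjoint cells. It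
  reflects that the sum of squared deviations has one degree of freedom less than the number of
  observations, and the growth rate of the regret depends on it.
\<close>

lemma (in prob_space) prob_common_cell_ge:
  fixes Y :: "'i \<Rightarrow> 'a \<Rightarrow> real" and f :: "real \<Rightarrow> real"
  assumes indep: "indep_vars (\<lambda>_. borel) Y I" and I: "finite I" "I \<noteq> {}"
    and distr: "\<And>m. m \<in> I \<Longrightarrow> distributed M lborel (Y m) f"
    and dens: "\<And>z. z \<in> {a..a + 1} \<Longrightarrow> \<delta> \<le> f z" and \<delta>: "0 \<le> \<delta>" and N: "0 < N"
  shows "\<delta> ^ card I / real N ^ (card I - 1)
      \<le> prob (\<Union>j<N. \<Inter>m\<in>I. Y m -` grid_cell a N j \<inter> space M)"
proof -
  define B where "B = (\<lambda>j. \<Inter>m\<in>I. Y m -` grid_cell a N j \<inter> space M)"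
  have meas: "Y m \<in> borel_measurable M" if "m \<in> I" for m
    using distributed_measurable[OF distr[OF that]] by simp
  have cell: "\<delta> / real N \<le> prob (Y m -` grid_cell a N j \<inter> space M)" if "m \<in> I" "j < N" for m j
  proof -
    have len: "(real j + 1) / real N - real j / real N = 1 / real N"
      by (simp add: diff_divide_distrib[symmetric])
    have "ennreal (\<delta> / real N) = (\<integral>\<^sup>+z. ennreal \<delta> * indicator (grid_cell a N j) z \<partial>lborel)"
      using \<delta> len N
      by (simp add: nn_integral_cmult_indicator grid_cell_def ennreal_mult[symmetric] divide_right_mono)
    also have "\<dots> \<le> (\<integral>\<^sup>+z. ennreal (f z) * indicator (grid_cell a N j) z \<partial>lborel)"
      using grid_cell_subset[OF that(2), of a]
      by (intro nn_integral_mono) (auto split: split_indicator intro!: ennreal_leI dens)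
    also have "\<dots> = emeasure M (Y m -` grid_cell a N j \<inter> space M)"
      by (rule distributed_emeasure[OF distr[OF that(1)], symmetric]) simp
    finally show ?thesis
      by (simp add: emeasure_eq_measure)
  qed
  have B_ge: "(\<delta> / real N) ^ card I \<le> prob (B j)" if "j < N" for j
  proof -
    have "(\<delta> / real N) ^ card I = (\<Prod>m\<in>I. \<delta> / real N)" by simp
    also have "\<dots> \<le> (\<Prod>m\<in>I. prob (Y m -` grid_cell a N j \<inter> space M))"
      using cell[OF _ that] \<delta> by (intro prod_mono) auto
    also have "\<dots> = prob (B j)"
      unfolding B_def using I
      by (intro indep_varsD[OF indep, symmetric]) auto
    finally show ?thesis .
  qed
  have B_sets: "B j \<in> events" for j
    unfolding B_def using I meas by (intro sets.finite_INT measurable_sets) auto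
  have disj: "disjoint_family_on B {..<N}"
    unfolding disjoint_family_on_def
  proof (intro ballI impI)
    fix i j :: nat assume "i \<noteq> j"
    show "B i \<inter> B j = {}"
    proof (rule ccontr)
      assume "B i \<inter> B j \<noteq> {}"
      then obtain \<omega> where w: "\<omega> \<in> B i" "\<omega> \<in> B j" by blast
      obtain m where "m \<in> I" using I by blast
      with w have "Y m \<omega> \<in> grid_cell a N i" "Y m \<omega> \<in> grid_cell a N j"
        unfolding B_def by blast+
      with \<open>i \<noteq> j\<close> show False using grid_cell_unique[OF N] by blast
    qed
  qed
  have "\<delta> ^ card I / real N ^ (card I - 1) = real N * (\<delta> / real N) ^ card I"
  proof -
    have "0 < card I" using I by (simp add: card_gt_0_iff)
    then obtain c where "card I = Suc c" using gr0_conv_Suc by auto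
    then show ?thesis using N by (simp add: power_divide)
  qed
  also have "\<dots> = (\<Sum>j<N. (\<delta> / real N) ^ card I)" by simp
  also have "\<dots> \<le> (\<Sum>j<N. prob (B j))"
    by (intro sum_mono B_ge) simp
  also have "\<dots> = prob (\<Union>j<N. B j)"
    using B_sets disj by (intro finite_measure_finite_Union[symmetric]) auto
  finally show ?thesis unfolding B_def .
qed

text \<open>This turns clustering of the observations into the smallness of the posterior scale.\<close>

lemma sample_mean_ss_bounds:
  assumes n: "1 \<le> n" and b: "\<And>m. m \<in> {1..n} \<Longrightarrow> X i m \<omega> \<in> {u..v}"
  shows "sample_mean X i n \<omega> \<in> {u..v}" and "sample_ss X i n \<omega> \<le> real n * (v - u)\<^sup>2"
proof -
  have "(\<Sum>m = 1..n. u) \<le> (\<Sum>m = 1..n. X i m \<omega>)" "(\<Sum>m = 1..n. X i m \<omega>) \<le> (\<Sum>m = 1..n. v)"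
    using b by (intro sum_mono; simp)+
  then show mean: "sample_mean X i n \<omega> \<in> {u..v}"
    using n by (simp add: sample_mean_def field_simps)
  have "(X i m \<omega> - sample_mean X i n \<omega>)\<^sup>2 \<le> (v - u)\<^sup>2" if "m \<in> {1..n}" for m
  proof -
    have "\<bar>X i m \<omega> - sample_mean X i n \<omega>\<bar> \<le> v - u"
      using mean b[OF that] by auto
    from power_mono[OF this, of 2] show ?thesis by simp
  qed
  then have "(\<Sum>m = 1..n. (X i m \<omega> - sample_mean X i n \<omega>)\<^sup>2) \<le> (\<Sum>m = 1..n. (v - u)\<^sup>2)"
    by (rule sum_mono)
  then show "sample_ss X i n \<omega> \<le> real n * (v - u)\<^sup>2"
    by (simp add: sample_ss_def)
qed


section \<open>Long absence of pulls of the better arm\<close>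

context thompson_sampling_known_arm2
begin

abbreviation "past_of \<equiv> past M X mt J (2 * init_pulls \<alpha>)"

lemma reward_measurable:
  assumes "i \<in> arms" "1 \<le> n"
  shows "X i n \<in> borel_measurable M"
  using distributed_measurable[OF rewards_normal[OF assms]] by simp

lemma sample_measurable:
  assumes "i \<in> arms" "2 * init_pulls \<alpha> < s"
  shows "mt i s \<in> borel_measurable M"
proof (cases "i = 1")
  case True
  then show ?thesis using assms sample1_measurable by simp
next
  case False
  then have "i = 2" using assms by (simp add: arms_def)
  then have "mt i s \<in> borel_measurable M \<longleftrightarrow> (\<lambda>_. mu 2) \<in> borel_measurable M"
    using assms sample2_known by (intro measurable_cong) auto
  then show ?thesis by simp
qed

lemma pull_event: "{\<omega> \<in> space M. J t \<omega> = 2} \<in> events" if "1 \<le> t"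
proof -
  have "J t -` {2} \<inter> space M \<in> events"
    using pulled_measurable[OF that] by (intro measurable_sets) auto
  moreover have "J t -` {2} \<inter> space M = {\<omega> \<in> space M. J t \<omega> = 2}" by auto
  ultimately show ?thesis by simp
qed

lemma past_subalgebra: "subalgebra M (past_of t)"
proof -
  define G where "G = {X i n -` A \<inter> space M | i n A. i \<in> arms \<and> 1 \<le> n \<and> A \<in> sets borel} \<union>
      {mt i s -` A \<inter> space M | i s A. i \<in> arms \<and> 2 * init_pulls \<alpha> < s \<and> s < t \<and> A \<in> sets borel} \<union>
      {J s -` A \<inter> space M | s A. 1 \<le> s \<and> s < t}"
  have "G \<subseteq> sets M"
    unfolding G_def using reward_measurable sample_measurable pulled_measurable
    by (auto intro: measurable_sets)
  moreover have "G \<subseteq> Pow (space M)"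
    unfolding G_def by auto
  moreover have "past_of t = sigma (space M) G"
    by (simp add: past_def G_def)
  ultimately show ?thesis
    by (simp add: subalgebra_def sets.sigma_sets_subset)
qed

lemma space_past: "space (past_of t) = space M"
  using past_subalgebra by (simp add: subalgebra_def)

lemma past_reward:
  assumes "i \<in> arms" "1 \<le> n" "A \<in> sets borel"
  shows "X i n -` A \<inter> space M \<in> sets (past_of t)"
  unfolding past_def using assms
  by (intro in_measure_of UnI1 CollectI exI conjI refl) auto

lemma past_sample:
  assumes "i \<in> arms" "2 * init_pulls \<alpha> < s" "s < t" "A \<in> sets borel"
  shows "mt i s -` A \<inter> space M \<in> sets (past_of t)"
  unfolding past_def using assms
  by (intro in_measure_of UnI1[OF UnI2] CollectI exI conjI refl) auto

text \<open>
  The event \<open>H\<close> belongs to the conditioning information of round \<open>t\<close>, so the indicator of the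
  sampled value can be replaced by its conditional expectation, a posterior probability, when it is
  integrated over \<open>H\<close>.
\<close>

lemma prob_sample1_in_le:
  assumes t: "2 * init_pulls \<alpha> < t" and H: "H \<in> sets (past_of t)" and A: "A \<in> sets borel"
    and bound: "\<And>\<omega>. \<omega> \<in> H \<Longrightarrow>
      measure (posterior \<alpha> (pulls J 1 t \<omega>) (sample_mean X 1 (pulls J 1 t \<omega>) \<omega>)
                 (sample_ss X 1 (pulls J 1 t \<omega>) \<omega>)) A \<le> p"
  shows "prob {\<omega> \<in> H. mt 1 t \<omega> \<in> A} \<le> p * prob H"
proof -
  interpret F: sigma_finite_subalgebra M "past_of t"
    by (intro finite_measure_subalgebra_is_sigma_finite finite_measure_subalgebra.intro
          finite_measure_subalgebra_axioms.intro past_subalgebra) unfold_locales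
  define f where "f = (\<lambda>\<omega>. indicator A (mt 1 t \<omega>) :: real)"
  have H_ev: "H \<in> events"
    using H past_subalgebra by (auto simp: subalgebra_def)
  have H_sub: "H \<subseteq> space M"
    using H_ev sets.sets_into_space by blast
  have mt_meas: "mt 1 t \<in> borel_measurable M"
    using sample1_measurable[OF t] .
  have f_meas: "f \<in> borel_measurable M"
    unfolding f_def by (rule measurable_compose[OF mt_meas borel_measurable_indicator[OF A]])
  have f_int: "integrable M f"
    by (rule integrable_const_bound[of _ 1, OF _ f_meas]) (simp add: f_def indicator_def)
  have ev: "{\<omega> \<in> H. mt 1 t \<omega> \<in> A} \<in> events"
  proof -
    have "{\<omega> \<in> H. mt 1 t \<omega> \<in> A} = H \<inter> (mt 1 t -` A \<inter> space M)"
      using H_sub by auto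
    then show ?thesis
      using H_ev measurable_sets[OF mt_meas A] by auto
  qed
  have "prob {\<omega> \<in> H. mt 1 t \<omega> \<in> A} = (LINT \<omega>|M. indicator {\<omega> \<in> H. mt 1 t \<omega> \<in> A} \<omega>)"
    using ev by simp
  also have "\<dots> = (LINT \<omega>:H|M. f \<omega>)"
    unfolding set_lebesgue_integral_def f_def
    by (intro Bochner_Integration.integral_cong) (auto split: split_indicator)
  also have "\<dots> = (LINT \<omega>:H|M. real_cond_exp M (past_of t) f \<omega>)"
    by (rule F.real_cond_exp_intA[OF f_int H])
  also have "\<dots> \<le> (LINT \<omega>|M. p * indicator H \<omega>)"
    unfolding set_lebesgue_integral_def
  proof (rule integral_mono_AE)
    show "integrable M (\<lambda>\<omega>. indicator H \<omega> *\<^sub>R real_cond_exp M (past_of t) f \<omega>)"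
      by (intro integrable_mult_indicator H_ev F.real_cond_exp_int f_int)
    show "integrable M (\<lambda>\<omega>. p * indicator H \<omega>)"
      using H_ev by (intro integrable_mult_right integrable_real_indicator)
        (auto simp: emeasure_eq_measure)
    show "AE \<omega> in M. indicator H \<omega> *\<^sub>R real_cond_exp M (past_of t) f \<omega> \<le> p * indicator H \<omega>"
      using sample1_posterior[OF t A] unfolding f_def
      by eventually_elim (use bound in \<open>auto split: split_indicator\<close>)
  qed
  also have "\<dots> = p * prob H"
    using H_ev by simp
  finally show ?thesis .
qed

lemma pulled_arm2:
  assumes "2 * init_pulls \<alpha> < t" "\<omega> \<in> space M" "mt 1 t \<omega> < mu 2"
  shows "J t \<omega> = 2"
proof -
  have "J t \<omega> \<in> arms" using assms by (intro pulled_arm) auto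
  moreover have "mt 2 t \<omega> \<le> mt (J t \<omega>) t \<omega>"
    using assms by (intro pull_maximal) (auto simp: arms_def)
  ultimately show ?thesis
    using assms sample2_known[OF assms(1,2)] by (auto simp: arms_def)
qed

text \<open>
  While the samples of arm 1 stay below \<open>mu 2\<close>, its posterior stays the one obtained after the
  initialisation.
\<close>

lemma pulls_stay:
  assumes t: "2 * init_pulls \<alpha> < t" and \<omega>: "\<omega> \<in> space M"
    and low: "\<And>s. s \<in> {2 * init_pulls \<alpha><..<t} \<Longrightarrow> mt 1 s \<omega> < mu 2"
  shows "pulls J 1 t \<omega> = init_pulls \<alpha>"
proof -
  have "{s \<in> {1..<t}. J s \<omega> = 1} = {s \<in> {1..<2 * init_pulls \<alpha> + 1}. J s \<omega> = 1}"
  proof -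
    have "s < 2 * init_pulls \<alpha> + 1" if "1 \<le> s" "s < t" "J s \<omega> = 1" for s
    proof (rule ccontr)
      assume "\<not> s < 2 * init_pulls \<alpha> + 1"
      then have "J s \<omega> = 2"
        using that \<omega> low by (intro pulled_arm2) auto
      with that show False by simp
    qed
    then show ?thesis using t by auto
  qed
  then have "pulls J 1 t \<omega> = pulls J 1 (2 * init_pulls \<alpha> + 1) \<omega>"
    by (simp add: pulls_def)
  then show ?thesis
    using init_phase[of 1 \<omega>] \<omega> by (simp add: arms_def)
qed

text \<open>
  A union bound over the \<open>d\<close> rounds that follow the initialisation. The next sample is at least
  \<open>mu 2\<close> with probability at most \<open>p\<close>, given \<open>G\<close> and low samples so far, since then the posterior is
  still the initial one; hence each round costs at most \<open>p * prob G\<close>.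
\<close>

lemma prob_samples1_stay_low:
  assumes G: "\<And>t. G \<in> sets (past_of t)" and p: "0 \<le> p"
    and bound: "\<And>\<omega>. \<omega> \<in> G \<Longrightarrow>
      measure (posterior \<alpha> (init_pulls \<alpha>) (sample_mean X 1 (init_pulls \<alpha>) \<omega>)
                 (sample_ss X 1 (init_pulls \<alpha>) \<omega>)) {mu 2..} \<le> p"
  shows "(1 - real d * p) * prob G
      \<le> prob {\<omega> \<in> G. \<forall>s\<in>{2 * init_pulls \<alpha><..2 * init_pulls \<alpha> + d}. mt 1 s \<omega> < mu 2}"
proof (induction d)
  case 0
  show ?case by simp
next
  case (Suc d)
  define t where "t = Suc (2 * init_pulls \<alpha> + d)"
  define H where "H = {\<omega> \<in> G. \<forall>s\<in>{2 * init_pulls \<alpha><..<t}. mt 1 s \<omega> < mu 2}"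
  have G_ev: "G \<in> events" and H_past: "H \<in> sets (past_of t)"
  proof -
    show "G \<in> events"
      using G past_subalgebra by (auto simp: subalgebra_def)
    then have G_sub: "G \<subseteq> space M"
      using sets.sets_into_space by blast
    have "H = G \<inter> (space M \<inter> (\<Inter>s\<in>{2 * init_pulls \<alpha><..<t}. mt 1 s -` {..<mu 2} \<inter> space M))"
      unfolding H_def using G_sub by auto
    also have "\<dots> \<in> sets (past_of t)"
    proof (cases "{2 * init_pulls \<alpha><..<t} = {}")
      case True
      have "G \<inter> space (past_of t) \<in> sets (past_of t)" using G by blast
      then show ?thesis using True by (simp add: space_past)
    next
      case False
      then have "(\<Inter>s\<in>{2 * init_pulls \<alpha><..<t}. mt 1 s -` {..<mu 2} \<inter> space M) \<in> sets (past_of t)"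
        by (intro sets.finite_INT past_sample) (auto simp: arms_def)
      moreover have "space M \<in> sets (past_of t)"
        using sets.top[of "past_of t"] by (simp add: space_past)
      ultimately show ?thesis using G by blast
    qed
    finally show "H \<in> sets (past_of t)" .
  qed
  have H_ev: "H \<in> events"
    using H_past past_subalgebra by (auto simp: subalgebra_def)
  have H_sub: "H \<subseteq> space M"
    using H_ev sets.sets_into_space by blast
  have "prob {\<omega> \<in> H. mt 1 t \<omega> \<in> {mu 2..}} \<le> p * prob H"
  proof (rule prob_sample1_in_le[OF _ H_past])
    fix \<omega> assume "\<omega> \<in> H"
    then have "\<omega> \<in> space M" "\<omega> \<in> G" "\<And>s. s \<in> {2 * init_pulls \<alpha><..<t} \<Longrightarrow> mt 1 s \<omega> < mu 2"
      using H_sub by (auto simp: H_def)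
    moreover from this have "pulls J 1 t \<omega> = init_pulls \<alpha>"
      by (intro pulls_stay) (auto simp: t_def)
    ultimately show "measure (posterior \<alpha> (pulls J 1 t \<omega>) (sample_mean X 1 (pulls J 1 t \<omega>) \<omega>)
                 (sample_ss X 1 (pulls J 1 t \<omega>) \<omega>)) {mu 2..} \<le> p"
      using bound by simp
  qed (simp_all add: t_def)
  also have "\<dots> \<le> p * prob G"
    using p G_ev by (intro mult_left_mono finite_measure_mono) (auto simp: H_def)
  finally have high: "prob {\<omega> \<in> H. mt 1 t \<omega> \<in> {mu 2..}} \<le> p * prob G" .
  have "mt 1 t \<in> borel_measurable M"
    by (rule sample1_measurable) (simp add: t_def)
  then have "H \<inter> (mt 1 t -` {mu 2..} \<inter> space M) \<in> events"
    using H_ev by (intro sets.Int measurable_sets) auto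
  moreover have high_eq: "H \<inter> (mt 1 t -` {mu 2..} \<inter> space M) = {\<omega> \<in> H. mt 1 t \<omega> \<in> {mu 2..}}"
    using H_sub by auto
  ultimately have high_ev: "{\<omega> \<in> H. mt 1 t \<omega> \<in> {mu 2..}} \<in> events" by simp
  have "{2 * init_pulls \<alpha><..2 * init_pulls \<alpha> + d} = {2 * init_pulls \<alpha><..<t}"
    by (auto simp: t_def)
  with Suc.IH have "(1 - real d * p) * prob G \<le> prob H"
    by (simp add: H_def)
  with high have "(1 - real (Suc d) * p) * prob G \<le> prob H - prob {\<omega> \<in> H. mt 1 t \<omega> \<in> {mu 2..}}"
    by (simp add: algebra_simps)
  also have "\<dots> = prob (H - {\<omega> \<in> H. mt 1 t \<omega> \<in> {mu 2..}})"
    using H_ev high_ev by (intro finite_measure_Diff[symmetric]) auto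
  also have "H - {\<omega> \<in> H. mt 1 t \<omega> \<in> {mu 2..}}
      = {\<omega> \<in> G. \<forall>s\<in>{2 * init_pulls \<alpha><..2 * init_pulls \<alpha> + Suc d}. mt 1 s \<omega> < mu 2}"
  proof -
    have "{2 * init_pulls \<alpha><..2 * init_pulls \<alpha> + Suc d} = insert t {2 * init_pulls \<alpha><..<t}"
      by (auto simp: t_def)
    then show ?thesis by (auto simp: H_def)
  qed
  finally show ?case .
qed

lemma init_pulls_ge: "2 \<le> init_pulls \<alpha>"
  unfolding init_pulls_def by linarith

text \<open>
  The bad event \<open>G\<close> is that the initial rewards of arm 1 share a cell of width \<open>1 / N\<close> in
  \<open>{mu 2 - 2..<mu 2 - 1}\<close>. If \<open>N\<close> is so large that the tail bounds of \<open>t\<close> rounds add up to at most 1/2,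
  then at least half of \<open>prob G\<close> remains after the union bound.
\<close>

lemma prob_pull_arm2_ge_grid:
  fixes \<delta> :: real and N t :: nat
  assumes \<alpha>: "0 \<le> \<alpha>" and \<delta>: "0 \<le> \<delta>" and N: "0 < N"
    and dens: "\<And>z. z \<in> {mu 2 - 2..mu 2 - 1} \<Longrightarrow> \<delta> \<le> normal_density (mu 1) (sd 1) z"
    and t: "2 * init_pulls \<alpha> < t"
    and N_large: "real t * (2 powr (real (init_pulls \<alpha>) / 2 + \<alpha>)
        * real N powr (- (real (init_pulls \<alpha>) + 2 * \<alpha> - 1))) \<le> 1 / 2"
  shows "\<delta> ^ init_pulls \<alpha> / real N ^ (init_pulls \<alpha> - 1) / 2 \<le> prob {\<omega> \<in> space M. J t \<omega> = 2}"
proof -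
  define n where "n = init_pulls \<alpha>"
  have n: "2 \<le> n" using init_pulls_ge by (simp add: n_def)
  define q where "q = real n + 2 * \<alpha> - 1"
  have q: "1 \<le> q" using n \<alpha> by (simp add: q_def)
  define p where "p = 2 powr (real n / 2 + \<alpha>) * real N powr (- q)"
  define a where "a = mu 2 - 2"
  define I where "I = {1::nat} \<times> {1..n}"
  define G where "G = (\<Union>j<N. \<Inter>m\<in>I. (\<lambda>(i, n). X i n) m -` grid_cell a N j \<inter> space M)"
  have "1 \<in> arms" by (simp add: arms_def)
  have I: "finite I" "I \<noteq> {}" "card I = n"
    using n by (auto simp: I_def)
  have G_ge: "\<delta> ^ n / real N ^ (n - 1) \<le> prob G"
    unfolding G_def I(3)[symmetric]
  proof (rule prob_common_cell_ge)
    show "indep_vars (\<lambda>_. borel) (\<lambda>(i, n). X i n) I"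
      using rewards_indep by (rule indep_vars_subset) (auto simp: I_def arms_def)
    show "distributed M lborel ((\<lambda>(i, n). X i n) m) (normal_density (mu 1) (sd 1))" if "m \<in> I" for m
      using that rewards_normal[OF \<open>1 \<in> arms\<close>] by (auto simp: I_def)
  qed (use I dens \<delta> N in \<open>auto simp: a_def\<close>)
  have G_past: "G \<in> sets (past_of s)" for s
  proof -
    have "(\<Inter>m\<in>I. (\<lambda>(i, n). X i n) m -` grid_cell a N j \<inter> space M) \<in> sets (past_of s)" for j
      using I by (intro sets.finite_INT) (auto simp: I_def arms_def intro!: past_reward)
    then show ?thesis
      unfolding G_def by (intro sets.finite_UN) auto
  qed
  have G_ev: "G \<in> events"
    using G_past past_subalgebra by (auto simp: subalgebra_def)
  have bound: "measure (posterior \<alpha> n (sample_mean X 1 n \<omega>) (sample_ss X 1 n \<omega>)) {mu 2..} \<le> p"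
    if "\<omega> \<in> G" for \<omega>
  proof -
    obtain j where j: "j < N" and cell: "\<And>m. m \<in> {1..n} \<Longrightarrow> X 1 m \<omega> \<in> grid_cell a N j"
    proof -
      obtain j where "j < N" and all: "\<omega> \<in> (\<Inter>m\<in>I. (\<lambda>(i, n). X i n) m -` grid_cell a N j \<inter> space M)"
        using that \<open>\<omega> \<in> G\<close> unfolding G_def by blast
      moreover have "X 1 m \<omega> \<in> grid_cell a N j" if "m \<in> {1..n}" for m
      proof -
        have "(1, m) \<in> I" using that by (simp add: I_def)
        from INT_D[OF all this] show ?thesis by simp
      qed
      ultimately show thesis using that by blast
    qed
    define x where "x = sample_mean X 1 n \<omega>"
    define S where "S = sample_ss X 1 n \<omega>"
    have in_cell: "X 1 m \<omega> \<in> {a + real j / real N..a + (real j + 1) / real N}" if "m \<in> {1..n}" for m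
      using cell[OF that] by (simp add: grid_cell_def)
    have len: "(a + (real j + 1) / real N) - (a + real j / real N) = 1 / real N"
      by (simp add: add_divide_distrib)
    have "(real j + 1) / real N \<le> 1"
      using j by simp
    moreover have "x \<le> a + (real j + 1) / real N"
      using sample_mean_ss_bounds(1)[of n X 1 \<omega>, OF _ in_cell] n unfolding x_def by auto
    ultimately have x: "1 \<le> mu 2 - x"
      unfolding a_def by linarith
    have S: "S \<le> real n * (1 / real N)\<^sup>2"
      using sample_mean_ss_bounds(2)[of n X 1 \<omega>, OF _ in_cell] n unfolding S_def len by simp
    have S0: "0 \<le> S"
      by (simp add: S_def sample_ss_def sum_nonneg)
    have "sqrt (S / real n) \<le> sqrt ((1 / real N)\<^sup>2)"
      using S n by (intro real_sqrt_le_mono) (simp add: field_simps)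
    then have r: "sqrt (S / real n) \<le> 1 / real N" by simp
    have "measure (posterior \<alpha> n x S) {mu 2..}
        \<le> 2 powr ((q + 1) / 2) / q * (sqrt (S / real n) / (mu 2 - x)) powr q"
      using n q S0 x by (intro posterior_tail_le) (auto simp: q_def)
    also have "\<dots> \<le> 2 powr ((q + 1) / 2) * (1 / real N) powr q"
    proof (intro mult_mono)
      show "2 powr ((q + 1) / 2) / q \<le> 2 powr ((q + 1) / 2)"
        using q by (simp add: divide_le_eq)
      have "sqrt (S / real n) / (mu 2 - x) \<le> sqrt (S / real n)"
        using divide_left_mono[OF x, of "sqrt (S / real n)"] x S0 by simp
      then show "(sqrt (S / real n) / (mu 2 - x)) powr q \<le> (1 / real N) powr q"
        using r q x S0 by (intro powr_mono2) auto
    qed auto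
    also have "\<dots> = p"
    proof -
      have "(q + 1) / 2 = real n / 2 + \<alpha>" by (simp add: q_def field_simps)
      moreover have "(1 / real N) powr q = real N powr (- q)"
        by (simp add: powr_divide powr_minus_divide)
      ultimately show ?thesis by (simp only: p_def)
    qed
    finally show ?thesis by (simp add: x_def S_def)
  qed
  define d where "d = t - 2 * n"
  have t_eq: "t = 2 * n + d" and d: "0 < d"
    using t by (auto simp: d_def n_def)
  have p0: "0 \<le> p" by (simp add: p_def)
  have "real d * p \<le> real t * p"
    using p0 t_eq by (intro mult_right_mono) auto
  also have "\<dots> \<le> 1 / 2"
    using N_large by (simp add: p_def q_def n_def)
  finally have "1 / 2 \<le> 1 - real d * p" by simp
  have "\<delta> ^ n / real N ^ (n - 1) / 2 \<le> 1 / 2 * prob G"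
    using G_ge by simp
  also have "\<dots> \<le> (1 - real d * p) * prob G"
    using \<open>1 / 2 \<le> 1 - real d * p\<close> by (intro mult_right_mono) auto
  also have "\<dots> \<le> prob {\<omega> \<in> G. \<forall>s\<in>{2 * n<..2 * n + d}. mt 1 s \<omega> < mu 2}"
    using prob_samples1_stay_low[OF G_past p0] bound by (simp add: n_def)
  also have "\<dots> \<le> prob {\<omega> \<in> space M. J t \<omega> = 2}"
  proof (rule finite_measure_mono)
    show "{\<omega> \<in> G. \<forall>s\<in>{2 * n<..2 * n + d}. mt 1 s \<omega> < mu 2} \<subseteq> {\<omega> \<in> space M. J t \<omega> = 2}"
    proof (rule subsetI)
      fix \<omega> assume \<omega>: "\<omega> \<in> {\<omega> \<in> G. \<forall>s\<in>{2 * n<..2 * n + d}. mt 1 s \<omega> < mu 2}"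
      then have "\<omega> \<in> space M"
        using sets.sets_into_space[OF G_ev] by blast
      moreover have "mt 1 t \<omega> < mu 2"
        using \<omega> t_eq d by auto
      ultimately show "\<omega> \<in> {\<omega> \<in> space M. J t \<omega> = 2}"
        using pulled_arm2[OF t] by blast
    qed
  qed (use t pull_event in simp)
  finally show ?thesis by (simp add: n_def)
qed

text \<open>
  The smallest admissible grid has \<open>N powr q\<close> about \<open>2 * C * t\<close>. Rounding up to an integer at most
  doubles \<open>N\<close>, which accounts for the factor 2 in \<open>c\<close>.
\<close>

lemma prob_pull_arm2_ge:
  fixes \<delta> \<gamma> c C q :: real and n t :: nat
  assumes \<alpha>: "0 \<le> \<alpha>" and \<delta>: "0 \<le> \<delta>"
    and dens: "\<And>z. z \<in> {mu 2 - 2..mu 2 - 1} \<Longrightarrow> \<delta> \<le> normal_density (mu 1) (sd 1) z"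
    and t: "2 * init_pulls \<alpha> < t"
    and n_def: "n = init_pulls \<alpha>" and q_def: "q = real n + 2 * \<alpha> - 1"
    and C_def: "C = 2 powr (real n / 2 + \<alpha>)" and \<gamma>_def: "\<gamma> = real (n - 1) / q"
    and c_def: "c = \<delta> ^ n / (2 * (2 * C) powr (1 / q)) ^ (n - 1) / 2"
  shows "c * real t powr (- \<gamma>) \<le> prob {\<omega> \<in> space M. J t \<omega> = 2}"
proof -
  have n: "2 \<le> n" using init_pulls_ge by (simp add: n_def)
  have q: "1 \<le> q" using n \<alpha> by (simp add: q_def)
  have t0: "1 \<le> real t" using t by simp
  have C: "1 \<le> C" using \<alpha> by (simp add: C_def ge_one_powr_ge_zero)
  define R where "R = (2 * C * real t) powr (1 / q)"
  define N where "N = nat \<lceil>R\<rceil>"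
  have one: "1 \<le> 2 * C * real t"
    using C t0 mult_mono[of 1 "2 * C" 1 "real t"] by simp
  then have R: "1 \<le> R"
    unfolding R_def using q by (intro ge_one_powr_ge_zero) auto
  have N: "R \<le> real N" "real N \<le> 2 * R" "0 < N"
    using R unfolding N_def by linarith+
  have "real t * (C * real N powr (- q)) \<le> 1 / 2"
  proof -
    have "2 * C * real t = R powr q"
      using q one by (simp add: R_def powr_powr)
    also have "\<dots> \<le> real N powr q"
      using N R q by (intro powr_mono2) auto
    finally show ?thesis
      using N by (simp add: powr_minus field_simps)
  qed
  then have "\<delta> ^ n / real N ^ (n - 1) / 2 \<le> prob {\<omega> \<in> space M. J t \<omega> = 2}"
    using prob_pull_arm2_ge_grid[OF \<alpha> \<delta> N(3) dens t] by (simp add: n_def q_def C_def)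
  moreover have "c * real t powr (- \<gamma>) \<le> \<delta> ^ n / real N ^ (n - 1) / 2"
  proof -
    have "real N ^ (n - 1) \<le> (2 * R) ^ (n - 1)"
      using N by (intro power_mono) auto
    also have "\<dots> = (2 * (2 * C) powr (1 / q)) ^ (n - 1) * (real t powr (1 / q)) ^ (n - 1)"
      using C t0 by (simp add: R_def powr_mult power_mult_distrib)
    also have "(real t powr (1 / q)) ^ (n - 1) = real t powr \<gamma>"
      using t0 by (simp add: powr_power \<gamma>_def)
    finally have le: "real N ^ (n - 1) \<le> (2 * (2 * C) powr (1 / q)) ^ (n - 1) * real t powr \<gamma>" .
    have "c * real t powr (- \<gamma>)
        = \<delta> ^ n / ((2 * (2 * C) powr (1 / q)) ^ (n - 1) * real t powr \<gamma>) / 2"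
      unfolding c_def powr_minus divide_inverse inverse_mult_distrib by (simp only: ac_simps)
    also have "\<dots> \<le> \<delta> ^ n / real N ^ (n - 1) / 2"
      using le N \<delta> C t0 by (intro divide_right_mono divide_left_mono mult_pos_pos zero_less_power) auto
    finally show ?thesis .
  qed
  ultimately show ?thesis by linarith
qed

section \<open>Regret\<close>

lemma expected_regret_eq:
  assumes "mu 2 < mu 1"
  shows "(\<integral>\<omega>. regret mu J T \<omega> \<partial>M)
      = (mu 1 - mu 2) * (\<Sum>t = 1..T. prob {\<omega> \<in> space M. J t \<omega> = 2})"
proof -
  have gap: "gap mu (J t \<omega>) = (mu 1 - mu 2) * indicator {\<omega> \<in> space M. J t \<omega> = 2} \<omega>"
    if "1 \<le> t" "\<omega> \<in> space M" for t \<omega>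
    using pulled_arm[OF that] that assms by (auto simp: gap_def arms_def)
  have "(\<integral>\<omega>. regret mu J T \<omega> \<partial>M)
      = (\<integral>\<omega>. (\<Sum>t = 1..T. (mu 1 - mu 2) * indicator {\<omega> \<in> space M. J t \<omega> = 2} \<omega>) \<partial>M)"
    unfolding regret_def by (intro Bochner_Integration.integral_cong sum.cong gap) auto
  also have "\<dots> = (\<Sum>t = 1..T. \<integral>\<omega>. (mu 1 - mu 2) * indicator {\<omega> \<in> space M. J t \<omega> = 2} \<omega> \<partial>M)"
    by (intro Bochner_Integration.integral_sum integrable_mult_right integrable_real_indicator pull_event)
      (auto simp: emeasure_eq_measure)
  also have "\<dots> = (\<Sum>t = 1..T. (mu 1 - mu 2) * prob {\<omega> \<in> space M. J t \<omega> = 2})"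
    by (intro sum.cong) (use pull_event in auto)
  finally show ?thesis by (simp add: sum_distrib_left)
qed

text \<open>Starting the sum after \<open>m\<close> leaves room for the initial pulls, whose order is arbitrary.\<close>

lemma expected_regret_ge:
  assumes "mu 2 < mu 1" and "\<And>t. m < t \<Longrightarrow> f t \<le> prob {\<omega> \<in> space M. J t \<omega> = 2}"
  shows "(mu 1 - mu 2) * (\<Sum>t\<in>{m<..T}. f t) \<le> (\<integral>\<omega>. regret mu J T \<omega> \<partial>M)"
proof -
  have "(\<Sum>t\<in>{m<..T}. f t) \<le> (\<Sum>t\<in>{m<..T}. prob {\<omega> \<in> space M. J t \<omega> = 2})"
    using assms(2) by (intro sum_mono) auto
  also have "\<dots> \<le> (\<Sum>t = 1..T. prob {\<omega> \<in> space M. J t \<omega> = 2})"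
    by (intro sum_mono2) auto
  finally show ?thesis
    using assms(1) by (simp add: expected_regret_eq mult_left_mono)
qed

text \<open>
  From \<open>\<gamma> \<le> 1\<close> each term is at least \<open>c / t\<close>. The harmonic sum over \<open>{m<..T}\<close> falls short of \<open>ln T\<close> by
  at most the constant \<open>harm m\<close>, and the factor 1/2 absorbs it for large \<open>T\<close>.
\<close>

lemma liminf_regret_over_log:
  assumes mu: "mu 2 < mu 1" and c: "0 \<le> c" and \<gamma>: "\<gamma> \<le> 1"
    and pull: "\<And>t. m < t \<Longrightarrow> c * real t powr (- \<gamma>) \<le> prob {\<omega> \<in> space M. J t \<omega> = 2}"
  shows "ereal ((mu 1 - mu 2) * c / 2)
      \<le> liminf (\<lambda>T. ereal ((\<integral>\<omega>. regret mu J T \<omega> \<partial>M) / ln (real T)))"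
proof (rule Liminf_bounded)
  have "filterlim (\<lambda>T. ln (real T)) at_top sequentially"
    using filterlim_compose[OF ln_at_top filterlim_real_sequentially] .
  then have "\<forall>\<^sub>F T in sequentially. max 1 (2 * harm m) \<le> ln (real T)"
    unfolding filterlim_at_top by blast
  then show "\<forall>\<^sub>F T in sequentially. ereal ((mu 1 - mu 2) * c / 2)
      \<le> ereal ((\<integral>\<omega>. regret mu J T \<omega> \<partial>M) / ln (real T))"
    using eventually_gt_at_top[of m]
  proof eventually_elim
    case (elim T)
    have T: "1 \<le> T" using elim by simp
    have "ln (real T) / 2 \<le> ln (real T) - harm m" using elim by simp
    also have "\<dots> \<le> harm T - harm m"
    proof -
      have "ln (real T) \<le> ln (real T + 1)" using T by simp
      with ln_le_harm[of T] show ?thesis by linarith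
    qed
    also have "\<dots> = (\<Sum>t\<in>{m<..T}. inverse (real t))"
    proof -
      have "{1..T} = {1..m} \<union> {m<..T}" using elim by auto
      then have "(harm T :: real) = harm m + (\<Sum>t\<in>{m<..T}. inverse (real t))"
        unfolding harm_def by (simp only:) (intro sum.union_disjoint; auto)
      then show ?thesis by simp
    qed
    finally have "c * (ln (real T) / 2) \<le> c * (\<Sum>t\<in>{m<..T}. inverse (real t))"
      using c by (rule mult_left_mono)
    also have "\<dots> = (\<Sum>t\<in>{m<..T}. c * inverse (real t))"
      by (rule sum_distrib_left)
    finally have sum: "c * (ln (real T) / 2) \<le> (\<Sum>t\<in>{m<..T}. c * inverse (real t))" .
    have "c * inverse (real t) \<le> prob {\<omega> \<in> space M. J t \<omega> = 2}" if "m < t" for t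
    proof -
      have "inverse (real t) = real t powr (- 1)"
        using that by (simp add: powr_minus)
      also have "\<dots> \<le> real t powr (- \<gamma>)"
        using that \<gamma> by (intro powr_mono) auto
      finally show ?thesis
        using pull[OF that] c mult_left_mono order_trans by blast
    qed
    from expected_regret_ge[OF mu this, of m T]
    have "(mu 1 - mu 2) * (c * (ln (real T) / 2)) \<le> (\<integral>\<omega>. regret mu J T \<omega> \<partial>M)"
      using sum mu mult_left_mono[OF sum, of "mu 1 - mu 2"] by linarith
    moreover have "0 < ln (real T)"
    proof -
      have "1 \<le> ln (real T)" using elim(1) by simp
      then show ?thesis by linarith
    qed
    ultimately show ?case by (simp add: field_simps)
  qed
qed

text \<open>
  Every term is at least the last one, \<open>c * T powr (- \<gamma>)\<close>, and the factor 1/2 absorbs the first \<open>m\<close>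
  rounds for large \<open>T\<close>.
\<close>

lemma liminf_regret_over_powr:
  assumes mu: "mu 2 < mu 1" and c: "0 \<le> c" and \<gamma>: "0 \<le> \<gamma>"
    and pull: "\<And>t. m < t \<Longrightarrow> c * real t powr (- \<gamma>) \<le> prob {\<omega> \<in> space M. J t \<omega> = 2}"
  shows "ereal ((mu 1 - mu 2) * c / 2)
      \<le> liminf (\<lambda>T. ereal ((\<integral>\<omega>. regret mu J T \<omega> \<partial>M) / real T powr (1 - \<gamma>)))"
proof (rule Liminf_bounded)
  show "\<forall>\<^sub>F T in sequentially. ereal ((mu 1 - mu 2) * c / 2)
      \<le> ereal ((\<integral>\<omega>. regret mu J T \<omega> \<partial>M) / real T powr (1 - \<gamma>))"
    using eventually_gt_at_top[of "2 * m"]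
  proof eventually_elim
    case (elim T)
    have T: "0 < real T" using elim by simp
    have "c / 2 * real T powr (1 - \<gamma>) = real T / 2 * (c * real T powr (- \<gamma>))"
      using T by (simp add: powr_diff powr_minus field_simps)
    also have "\<dots> \<le> real (T - m) * (c * real T powr (- \<gamma>))"
      using elim c by (intro mult_right_mono) auto
    also have "\<dots> = (\<Sum>t\<in>{m<..T}. c * real T powr (- \<gamma>))"
      by simp
    also have "\<dots> \<le> (\<Sum>t\<in>{m<..T}. c * real t powr (- \<gamma>))"
      using c \<gamma> by (intro sum_mono mult_left_mono powr_mono2') auto
    finally have "(mu 1 - mu 2) * (c / 2 * real T powr (1 - \<gamma>))
        \<le> (mu 1 - mu 2) * (\<Sum>t\<in>{m<..T}. c * real t powr (- \<gamma>))"
      using mu by (intro mult_left_mono) auto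
    also have "\<dots> \<le> (\<integral>\<omega>. regret mu J T \<omega> \<partial>M)"
      by (rule expected_regret_ge[OF mu pull])
    finally show ?case
      using T by (simp add: field_simps)
  qed
qed

end

theorem theorem2:
  fixes mu sd :: "nat \<Rightarrow> real" and \<alpha> :: real
  assumes "mu 1 > mu 2" and "sd 1 > 0" and "\<alpha> \<ge> 0"
  shows
    "(\<exists>\<xi>>0. \<forall>\<sigma>2>0. \<forall>(M :: 'a measure) X mt J.
        thompson_sampling_known_arm2 M mu (sd(2 := \<sigma>2)) X \<alpha> mt J \<longrightarrow>
        liminf (\<lambda>T. ereal ((\<integral>\<omega>. regret mu J T \<omega> \<partial>M) / ln (real T))) \<ge> ereal \<xi>) \<and>
     (\<alpha> > 0 \<longrightarrow>
      (\<exists>\<xi>'>0. \<exists>\<eta>>0. \<forall>\<sigma>2>0. \<forall>(M :: 'a measure) X mt J.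
        thompson_sampling_known_arm2 M mu (sd(2 := \<sigma>2)) X \<alpha> mt J \<longrightarrow>
        liminf (\<lambda>T. ereal ((\<integral>\<omega>. regret mu J T \<omega> \<partial>M) / real T powr \<eta>)) \<ge> ereal \<xi>'))"
proof -
  obtain z where "\<forall>y\<in>{mu 2 - 2..mu 2 - 1}. normal_density (mu 1) (sd 1) z \<le> normal_density (mu 1) (sd 1) y"
  proof -
    \<comment> \<open>The density is positive, so its minimum over a compact interval is a positive lower bound.\<close>
    have "continuous_on {mu 2 - 2..mu 2 - 1} (normal_density (mu 1) (sd 1))"
      unfolding normal_density_def using assms(2) by (intro continuous_intros) auto
    from continuous_attains_inf[OF _ _ this] that show thesis by auto
  qed
  moreover define \<delta> where "\<delta> = normal_density (mu 1) (sd 1) z"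
  ultimately have dens: "\<And>y. y \<in> {mu 2 - 2..mu 2 - 1} \<Longrightarrow> \<delta> \<le> normal_density (mu 1) (sd 1) y"
    by blast
  have \<delta>: "0 < \<delta>"
    using assms(2) by (simp add: \<delta>_def normal_density_pos)
  define n where "n = init_pulls \<alpha>"
  define q where "q = real n + 2 * \<alpha> - 1"
  define C where "C = 2 powr (real n / 2 + \<alpha>)"
  define \<gamma> where "\<gamma> = real (n - 1) / q"
  define c where "c = \<delta> ^ n / (2 * (2 * C) powr (1 / q)) ^ (n - 1) / 2"
  have n: "2 \<le> n"
    unfolding n_def init_pulls_def by linarith
  have q: "1 \<le> q" using n assms(3) by (simp add: q_def)
  have \<gamma>: "0 \<le> \<gamma>" "\<gamma> \<le> 1" "0 < \<alpha> \<Longrightarrow> \<gamma> < 1"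
    using n q assms(3) by (auto simp: \<gamma>_def q_def of_nat_diff)
  have c: "0 < c"
    using \<delta> by (simp add: c_def C_def)
  have pull: "c * real t powr (- \<gamma>) \<le> measure M {\<omega> \<in> space M. J t \<omega> = 2}"
    if "thompson_sampling_known_arm2 M mu (sd(2 := \<sigma>2)) X \<alpha> mt J" "2 * n < t"
    for \<sigma>2 and M :: "'a measure" and X mt J t
    by (rule thompson_sampling_known_arm2.prob_pull_arm2_ge[OF that(1) assms(3), where \<delta> = \<delta>])
      (use that(2) \<delta> dens in \<open>auto simp: n_def q_def C_def \<gamma>_def c_def\<close>)
  have pos: "0 < (mu 1 - mu 2) * c / 2"
    using assms(1) c by simp
  show ?thesis
  proof (intro conjI impI)
    show "\<exists>\<xi>>0. \<forall>\<sigma>2>0. \<forall>(M :: 'a measure) X mt J.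
        thompson_sampling_known_arm2 M mu (sd(2 := \<sigma>2)) X \<alpha> mt J \<longrightarrow>
        liminf (\<lambda>T. ereal ((\<integral>\<omega>. regret mu J T \<omega> \<partial>M) / ln (real T))) \<ge> ereal \<xi>"
    proof (intro exI[of _ "(mu 1 - mu 2) * c / 2"] conjI allI impI pos)
      fix \<sigma>2 and M :: "'a measure" and X mt J
      assume ts: "thompson_sampling_known_arm2 M mu (sd(2 := \<sigma>2)) X \<alpha> mt J"
      show "ereal ((mu 1 - mu 2) * c / 2)
          \<le> liminf (\<lambda>T. ereal ((\<integral>\<omega>. regret mu J T \<omega> \<partial>M) / ln (real T)))"
        by (rule thompson_sampling_known_arm2.liminf_regret_over_log
            [OF ts assms(1) less_imp_le[OF c] \<gamma>(2) pull[OF ts]])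
    qed
  next
    assume "0 < \<alpha>"
    then have \<eta>: "0 < 1 - \<gamma>" using \<gamma> by simp
    show "\<exists>\<xi>'>0. \<exists>\<eta>>0. \<forall>\<sigma>2>0. \<forall>(M :: 'a measure) X mt J.
        thompson_sampling_known_arm2 M mu (sd(2 := \<sigma>2)) X \<alpha> mt J \<longrightarrow>
        liminf (\<lambda>T. ereal ((\<integral>\<omega>. regret mu J T \<omega> \<partial>M) / real T powr \<eta>)) \<ge> ereal \<xi>'"
    proof (rule exI[of _ "(mu 1 - mu 2) * c / 2"], intro conjI pos,
        rule exI[of _ "1 - \<gamma>"], intro conjI allI impI \<eta>)
      fix \<sigma>2 and M :: "'a measure" and X mt J
      assume ts: "thompson_sampling_known_arm2 M mu (sd(2 := \<sigma>2)) X \<alpha> mt J"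
      show "ereal ((mu 1 - mu 2) * c / 2)
          \<le> liminf (\<lambda>T. ereal ((\<integral>\<omega>. regret mu J T \<omega> \<partial>M) / real T powr (1 - \<gamma>)))"
        by (rule thompson_sampling_known_arm2.liminf_regret_over_powr
            [OF ts assms(1) less_imp_le[OF c] \<gamma>(1) pull[OF ts]])
    qed
  qed
qed

end
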